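(* Let $Q_8 = \langle r,s \mid r^4=1,\; s^2=r^2,\; s^{-1}rs = r^{-1} \rangle$ be the quaternion group, and let $\rho : Q_8 \to GL_2(\mathbb{C})$ be the representation given by $$\rho(r) = \begin{bmatrix} i & 0 \\ 0 & -i \end{bmatrix},\qquad \rho(s) = \begin{bmatrix} 0 & -1 \\ 1 & 0 \end{bmatrix}.$$ Then $\mathrm{HS}(\rho(Q_8)) = \Pi_4$.
   Context: For a set $S \subseteq M_m(\mathbb{C})$, $\mathrm{Co}(S)$ denotes the set of all (finite) convex combinations of elements of $S$, and the hull spectrum $\mathrm{HS}(S)\subseteq\mathbb{C}$ is the set of all complex numbers that occur as eigenvalues of some matrix in $\mathrm{Co}(S)$. $\rho(Q_8)$ denotes the image of $\rho$. $\Pi_4$ denotes the convex hull in $\mathbb{C}$ of the fourth roots of unity. *)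

theory Defs
  imports "HOL-Analysis.Analysis" "HOL-Algebra.Group"
begin

section \<open>Groups given by generators and relations\<close>

text \<open>
  A word is a list of letters; \<open>(x, True)\<close> stands for the generator \<open>x\<close> and
  \<open>(x, False)\<close> for its formal inverse.  A relation \<open>u = v\<close> is a pair of words.
\<close>

type_synonym 'g word = "('g \<times> bool) list"

inductive pres_eq :: "('g word \<times> 'g word) set \<Rightarrow> 'g word \<Rightarrow> 'g word \<Rightarrow> bool"
  for R :: "('g word \<times> 'g word) set"
where
  relation: "(u, v) \<in> R \<Longrightarrow> pres_eq R u v"
| cancel: "pres_eq R [(x, b), (x, \<not> b)] []"
| refl: "pres_eq R u u"
| sym: "pres_eq R u v \<Longrightarrow> pres_eq R v u"
| trans: "pres_eq R u v \<Longrightarrow> pres_eq R v w \<Longrightarrow> pres_eq R u w"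
| append: "pres_eq R u u' \<Longrightarrow> pres_eq R v v' \<Longrightarrow> pres_eq R (u @ v) (u' @ v')"

definition pres_class :: "('g word \<times> 'g word) set \<Rightarrow> 'g word \<Rightarrow> 'g word set"
  where "pres_class R u = {v. pres_eq R u v}"

definition presented_group :: "('g word \<times> 'g word) set \<Rightarrow> 'g word set monoid"
  where "presented_group R =
    \<lparr> carrier = range (pres_class R),
      mult = (\<lambda>A B. \<Union>u\<in>A. \<Union>v\<in>B. pres_class R (u @ v)),
      one = pres_class R [] \<rparr>"

definition pres_gen :: "('g word \<times> 'g word) set \<Rightarrow> 'g \<Rightarrow> 'g word set"
  where "pres_gen R x = pres_class R [(x, True)]"

lemma pres_class_eq_iff: "pres_class R u = pres_class R v \<longleftrightarrow> pres_eq R u v"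
  unfolding pres_class_def set_eq_iff mem_Collect_eq
  by (meson pres_eq.refl pres_eq.sym pres_eq.trans)

lemma pres_mult:
  "pres_class R u \<otimes>\<^bsub>presented_group R\<^esub> pres_class R v = pres_class R (u @ v)"
proof -
  have "pres_class R (u' @ v') = pres_class R (u @ v)"
    if "u' \<in> pres_class R u" "v' \<in> pres_class R v" for u' v'
    using that unfolding pres_class_eq_iff
    by (auto simp: pres_class_def intro: pres_eq.append pres_eq.sym)
  moreover have "u \<in> pres_class R u" "v \<in> pres_class R v"
    by (auto simp: pres_class_def pres_eq.refl)
  ultimately show ?thesis
    unfolding presented_group_def monoid.select_convs by blast
qed

lemma carrier_presented_group: "carrier (presented_group R) = range (pres_class R)"
  by (simp add: presented_group_def)

lemma one_presented_group: "\<one>\<^bsub>presented_group R\<^esub> = pres_class R []"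
  by (simp add: presented_group_def)

lemma pres_gen_closed: "pres_gen R x \<in> carrier (presented_group R)"
  by (simp add: pres_gen_def carrier_presented_group)

lemma pres_eq_inverse: "\<exists>v. pres_eq R (v @ u) []"
proof (induction u)
  case Nil
  show ?case using pres_eq.refl[of R "[]"] by (intro exI[of _ "[]"]) simp
next
  case (Cons a u)
  then obtain v where v: "pres_eq R (v @ u) []" by blast
  obtain x b where a: "a = (x, b)" by (cases a)
  have "pres_eq R ([(x, \<not> b), (x, \<not> \<not> b)] @ u) ([] @ u)"
    by (intro pres_eq.append pres_eq.cancel pres_eq.refl)
  then have "pres_eq R (v @ ([(x, \<not> b), (x, b)] @ u)) (v @ u)"
    by (intro pres_eq.append pres_eq.refl) simp
  then have "pres_eq R ((v @ [(x, \<not> b)]) @ a # u) []"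
    using v a by (auto intro: pres_eq.trans)
  then show ?case by blast
qed

lemma group_presented_group: "group (presented_group R)"
proof (rule groupI)
  fix A assume "A \<in> carrier (presented_group R)"
  then obtain u where A: "A = pres_class R u" by (auto simp: carrier_presented_group)
  obtain v where "pres_eq R (v @ u) []" using pres_eq_inverse by blast
  then have "pres_class R v \<otimes>\<^bsub>presented_group R\<^esub> A = \<one>\<^bsub>presented_group R\<^esub>"
    by (simp add: A pres_mult one_presented_group pres_class_eq_iff)
  then show "\<exists>B\<in>carrier (presented_group R). B \<otimes>\<^bsub>presented_group R\<^esub> A = \<one>\<^bsub>presented_group R\<^esub>"
    by (auto simp: carrier_presented_group)
qed (auto simp: carrier_presented_group one_presented_group pres_mult)

definition letter_value :: "('a, 'b) monoid_scheme \<Rightarrow> ('g \<Rightarrow> 'a) \<Rightarrow> 'g \<times> bool \<Rightarrow> 'a"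
  where "letter_value G f l = (if snd l then f (fst l) else inv\<^bsub>G\<^esub> f (fst l))"

definition word_value :: "('a, 'b) monoid_scheme \<Rightarrow> ('g \<Rightarrow> 'a) \<Rightarrow> 'g word \<Rightarrow> 'a"
  where "word_value G f w = foldr (\<lambda>l a. letter_value G f l \<otimes>\<^bsub>G\<^esub> a) w \<one>\<^bsub>G\<^esub>"

lemma presented_group_universal:
  assumes G: "group G" and f: "\<And>x. f x \<in> carrier G"
    and rels: "\<And>u v. (u, v) \<in> R \<Longrightarrow> word_value G f u = word_value G f v"
  shows "\<exists>h \<in> hom (presented_group R) G. \<forall>x. h (pres_gen R x) = f x"
proof -
  interpret group G by fact
  let ?w = "word_value G f"
  have letter [simp]: "letter_value G f l \<in> carrier G" for l
    using f by (auto simp: letter_value_def)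
  have closed [simp]: "?w w \<in> carrier G" for w
    by (induction w) (auto simp: word_value_def)
  have Nil [simp]: "?w [] = \<one>\<^bsub>G\<^esub>"
    by (simp add: word_value_def)
  have Cons: "?w (l # w) = letter_value G f l \<otimes>\<^bsub>G\<^esub> ?w w" for l w
    by (simp add: word_value_def)
  have app: "?w (u @ v) = ?w u \<otimes>\<^bsub>G\<^esub> ?w v" for u v
    by (induction u) (auto simp: Cons m_assoc)
  have inv: "?w u = ?w v" if "pres_eq R u v" for u v
    using that
  proof induction
    case (cancel x b)
    then show ?case using f by (simp add: Cons letter_value_def)
  qed (auto simp: rels app)
  define h where "h A = ?w (SOME u. u \<in> A)" for A
  have h: "h (pres_class R u) = ?w u" for u
  proof -
    have "u \<in> pres_class R u" by (simp add: pres_class_def pres_eq.refl)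
    then have "(SOME u'. u' \<in> pres_class R u) \<in> pres_class R u" by (rule someI)
    then show ?thesis unfolding h_def using inv by (auto simp: pres_class_def)
  qed
  have "h \<in> hom (presented_group R) G"
    by (rule homI) (auto simp: carrier_presented_group pres_mult h app)
  moreover have "h (pres_gen R x) = f x" for x
    using f by (simp add: pres_gen_def h Cons letter_value_def)
  ultimately show ?thesis by blast
qed

section \<open>The quaternion group and its representation\<close>

datatype Q8_generator = r | s

definition Q8_relations :: "(Q8_generator word \<times> Q8_generator word) set"
  where "Q8_relations =
    {([(r, True), (r, True), (r, True), (r, True)], []),
     ([(s, True), (s, True)], [(r, True), (r, True)]),
     ([(s, False), (r, True), (s, True)], [(r, False)])}"

definition Q8 :: "Q8_generator word set monoid"
  where "Q8 = presented_group Q8_relations"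

definition Q8_r :: "Q8_generator word set"
  where "Q8_r = pres_gen Q8_relations r"

definition Q8_s :: "Q8_generator word set"
  where "Q8_s = pres_gen Q8_relations s"

hide_const (open) r s

definition GL :: "(complex ^ 'n ^ 'n) monoid"
  where "GL = \<lparr> carrier = {A. invertible A}, mult = (**), one = mat 1 \<rparr>"

definition rho_r :: "complex ^ 2 ^ 2"
  where "rho_r = vector [vector [\<i>, 0], vector [0, - \<i>]]"

definition rho_s :: "complex ^ 2 ^ 2"
  where "rho_s = vector [vector [0, - 1], vector [1, 0]]"

lemma group_GL: "group (GL :: (complex ^ 'n ^ 'n) monoid)"
proof (rule groupI)
  fix A :: "complex ^ 'n ^ 'n" assume "A \<in> carrier GL"
  then obtain B where "A ** B = mat 1" "B ** A = mat 1"
    by (auto simp: GL_def invertible_def)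
  then show "\<exists>B\<in>carrier GL. B \<otimes>\<^bsub>GL\<^esub> A = \<one>\<^bsub>GL\<^esub>"
    by (auto simp: GL_def invertible_def)
qed (auto simp: GL_def invertible_mult matrix_mul_assoc invertible_def[of "mat 1"])

text \<open>
  The matrices satisfy the defining relations, so they do determine a representation.
\<close>

lemma rho_exists:
  "\<exists>\<rho> \<in> hom Q8 GL. \<rho> Q8_r = rho_r \<and> \<rho> Q8_s = rho_s"
proof -
  interpret group "GL :: (complex ^ 2 ^ 2) monoid" by (rule group_GL)
  have mm: "(A ** B) $ i $ j = A $ i $ 1 * B $ 1 $ j + A $ i $ 2 * B $ 2 $ j"
    for A B :: "complex ^ 2 ^ 2" and i j
    by (simp add: matrix_matrix_mult_def sum_2)
  note ms = vec_eq_iff forall_2 mm rho_r_def rho_s_def mat_def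
  have rr: "rho_r ** - rho_r = mat 1" "- rho_r ** rho_r = mat 1"
    and ss: "rho_s ** - rho_s = mat 1" "- rho_s ** rho_s = mat 1"
    by (simp_all add: ms)
  then have c: "rho_r \<in> carrier GL" "rho_s \<in> carrier GL"
    "- rho_r \<in> carrier GL" "- rho_s \<in> carrier GL"
    by (auto simp: GL_def invertible_def)
  have i: "inv\<^bsub>GL\<^esub> rho_r = - rho_r" "inv\<^bsub>GL\<^esub> rho_s = - rho_s"
    using rr ss c by (intro inv_equality; simp add: GL_def)+
  let ?f = "\<lambda>x. case x of Q8_generator.r \<Rightarrow> rho_r | Q8_generator.s \<Rightarrow> rho_s"
  have "\<exists>h \<in> hom (presented_group Q8_relations) GL. \<forall>x. h (pres_gen Q8_relations x) = ?f x"
  proof (rule presented_group_universal[OF group_GL])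
    show "?f x \<in> carrier GL" for x using c by (cases x) auto
    show "word_value GL ?f u = word_value GL ?f v" if "(u, v) \<in> Q8_relations" for u v
      using that unfolding Q8_relations_def
      by (auto simp: word_value_def letter_value_def i) (simp_all add: GL_def ms)
  qed
  then obtain h where "h \<in> hom (presented_group Q8_relations) GL"
    and h: "\<And>x. h (pres_gen Q8_relations x) = ?f x" by blast
  then show ?thesis
    unfolding Q8_def Q8_r_def Q8_s_def by (intro bexI[of _ h]) (simp_all add: h)
qed

section \<open>Hull spectrum\<close>

definition is_eigenvalue :: "complex ^ 'n ^ 'n \<Rightarrow> complex \<Rightarrow> bool"
  where "is_eigenvalue A c \<longleftrightarrow> (\<exists>v. v \<noteq> 0 \<and> A *v v = c *s v)"

text \<open>\<open>convex hull S\<close> is the set of finite convex combinations (\<open>convex_hull_explicit\<close>).\<close>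

definition hull_spectrum :: "(complex ^ 'n ^ 'n) set \<Rightarrow> complex set"
  where "hull_spectrum S = {c. \<exists>A \<in> convex hull S. is_eigenvalue A c}"

definition Pi_polygon :: "nat \<Rightarrow> complex set"
  where "Pi_polygon n = convex hull {z. z ^ n = 1}"

end

theory Submission
  imports Defs
begin

text \<open>
  The span of \<open>\<rho>(Q\<^sub>8)\<close> over the reals is the quaternion algebra, and the convex hull of the image
  lies in the unit ball of its \<open>\<ell>\<^sup>1\<close> norm, which is convex and stable under left multiplication by
  the generators. A quaternion with coordinates \<open>a, b, c, d\<close> has the eigenvalues
  \<open>a \<plusminus> i \<surd>(b\<^sup>2 + c\<^sup>2 + d\<^sup>2)\<close>, and \<open>\<surd>(b\<^sup>2 + c\<^sup>2 + d\<^sup>2) \<le> \<bar>b\<bar> + \<bar>c\<bar> + \<bar>d\<bar>\<close>, so all of them lie in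
  \<open>\<Pi>\<^sub>4 = {x + iy. \<bar>x\<bar> + \<bar>y\<bar> \<le> 1}\<close>. Conversely \<open>x + iy\<close> is an eigenvalue of \<open>x I + y \<rho>(r)\<close>.
\<close>

text \<open>The quaternion \<open>a + b i + c j + d k\<close>, with \<open>i\<close>,
  \<open>j\<close>, \<open>k\<close> realised as \<open>rho_r\<close>, \<open>rho_s\<close> and
  \<open>rho_r ** rho_s\<close>.\<close>

definition quat :: "real \<Rightarrow> real \<Rightarrow> real \<Rightarrow> real \<Rightarrow> complex ^ 2 ^ 2"
  where "quat a b c d = vector [vector [Complex a b, Complex (- c) (- d)],
                                vector [Complex c (- d), Complex a (- b)]]"

definition quat_ball :: "(complex ^ 2 ^ 2) set"
  where "quat_ball = {quat a b c d | a b c d. \<bar>a\<bar> + \<bar>b\<bar> + \<bar>c\<bar> + \<bar>d\<bar> \<le> 1}"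

lemma quat_ballI: "\<bar>a\<bar> + \<bar>b\<bar> + \<bar>c\<bar> + \<bar>d\<bar> \<le> 1 \<Longrightarrow> quat a b c d \<in> quat_ball"
  by (auto simp: quat_ball_def)

lemma matrix_mult_2:
  "(A ** B) $ i $ j = A $ i $ 1 * B $ 1 $ j + A $ i $ 2 * B $ 2 $ j"
  for A B :: "complex ^ 2 ^ 2"
  by (simp add: matrix_matrix_mult_def sum_2)

lemmas mat2_simps = vec_eq_iff forall_2 matrix_mult_2 rho_r_def rho_s_def mat_def quat_def
  complex_eq_iff

lemma quat_one: "quat 1 0 0 0 = mat 1"
  by (simp add: mat2_simps)

lemma quat_mult_left:
  "rho_r ** quat a b c d = quat (- b) a (- d) c"
  "rho_s ** quat a b c d = quat (- c) d a (- b)"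
  "- rho_r ** quat a b c d = quat b (- a) d (- c)"
  "- rho_s ** quat a b c d = quat c (- d) (- a) b"
  by (simp_all add: mat2_simps)

text \<open>By \<open>quat_mult_left\<close>, each of these matrices permutes the four coordinates
  up to sign, so the sum of their absolute values is preserved.\<close>

lemma quat_ball_mult_left:
  assumes "A \<in> {rho_r, rho_s, - rho_r, - rho_s}" "B \<in> quat_ball"
  shows "A ** B \<in> quat_ball"
proof -
  from assms(2) obtain a b c d where "B = quat a b c d" "\<bar>a\<bar> + \<bar>b\<bar> + \<bar>c\<bar> + \<bar>d\<bar> \<le> 1"
    by (auto simp: quat_ball_def)
  then show ?thesis
    using assms(1) by (auto simp only: quat_mult_left insert_iff empty_iff intro!: quat_ballI)
qed

lemma convex_quat_ball: "convex quat_ball"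
proof (rule convexI)
  fix A B :: "complex ^ 2 ^ 2" and u v :: real
  assume "A \<in> quat_ball" "B \<in> quat_ball" and uv: "0 \<le> u" "0 \<le> v" "u + v = 1"
  then obtain a b c d a' b' c' d'
    where A: "A = quat a b c d" "\<bar>a\<bar> + \<bar>b\<bar> + \<bar>c\<bar> + \<bar>d\<bar> \<le> 1"
      and B: "B = quat a' b' c' d'" "\<bar>a'\<bar> + \<bar>b'\<bar> + \<bar>c'\<bar> + \<bar>d'\<bar> \<le> 1"
    by (auto simp: quat_ball_def)
  have sum: "u *\<^sub>R A + v *\<^sub>R B
      = quat (u * a + v * a') (u * b + v * b') (u * c + v * c') (u * d + v * d')"
    by (simp add: A B mat2_simps)
  have tri: "\<bar>u * x + v * y\<bar> \<le> u * \<bar>x\<bar> + v * \<bar>y\<bar>" for x y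
    using uv abs_triangle_ineq[of "u * x" "v * y"] by (simp add: abs_mult)
  have "\<bar>u * a + v * a'\<bar> + \<bar>u * b + v * b'\<bar> + \<bar>u * c + v * c'\<bar> + \<bar>u * d + v * d'\<bar>
      \<le> u * (\<bar>a\<bar> + \<bar>b\<bar> + \<bar>c\<bar> + \<bar>d\<bar>) + v * (\<bar>a'\<bar> + \<bar>b'\<bar> + \<bar>c'\<bar> + \<bar>d'\<bar>)"
    using tri[of a a'] tri[of b b'] tri[of c c'] tri[of d d'] unfolding distrib_left by linarith
  also have "\<dots> \<le> u * 1 + v * 1"
    by (intro add_mono mult_left_mono A B uv)
  finally show "u *\<^sub>R A + v *\<^sub>R B \<in> quat_ball"
    unfolding sum using uv by (intro quat_ballI) simp
qed

text \<open>The characteristic polynomial is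
  \<open>(z - a)\<^sup>2 + b\<^sup>2 + c\<^sup>2 + d\<^sup>2\<close>; its vanishing is split into
  real and imaginary parts.\<close>

lemma quat_eigenvalue:
  assumes "is_eigenvalue (quat a b c d) z"
  shows "Re z = a \<and> (Im z)\<^sup>2 = b\<^sup>2 + c\<^sup>2 + d\<^sup>2"
proof -
  obtain v where v: "v \<noteq> 0" "quat a b c d *v v = z *s v"
    using assms by (auto simp: is_eigenvalue_def)
  define x y where "x = v $ 1" and "y = v $ 2"
  have e1: "Complex a b * x + Complex (- c) (- d) * y = z * x"
    and e2: "Complex c (- d) * x + Complex a (- b) * y = z * y"
    using v(2) by (simp_all add: vec_eq_iff forall_2 matrix_vector_mult_def sum_2 quat_def x_def y_def)
  let ?p = "Complex a b" and ?q = "Complex (- c) (- d)" and ?r = "Complex c (- d)" and ?s = "Complex a (- b)"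
  have "(?p - z) * (?s - z) - ?q * ?r = 0" (is "?D = 0")
  proof -
    \<comment> \<open>Cramer's rule: applying the adjugate of the matrix minus \<open>z\<close> to
      the eigenvector equations isolates \<open>?D * x\<close> and \<open>?D * y\<close>.\<close>
    have "?D * x = (?s - z) * (?p * x + ?q * y - z * x) - ?q * (?r * x + ?s * y - z * y)"
      and "?D * y = (?p - z) * (?r * x + ?s * y - z * y) - ?r * (?p * x + ?q * y - z * x)"
      by (simp_all only: algebra_simps)
    then have "?D * x = 0" "?D * y = 0"
      by (simp_all add: e1 e2)
    moreover have "x \<noteq> 0 \<or> y \<noteq> 0"
      using v(1) by (auto simp: vec_eq_iff forall_2 x_def y_def)
    ultimately show ?thesis by auto
  qed
  then have re: "(Re z - a)\<^sup>2 - (Im z)\<^sup>2 + (b\<^sup>2 + c\<^sup>2 + d\<^sup>2) = 0" and im: "(Re z - a) * Im z = 0"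
    by (simp_all add: complex_eq_iff power2_eq_square algebra_simps)
  have "Re z = a"
  proof (rule ccontr)
    assume "Re z \<noteq> a"
    with im have "Im z = 0" and "(Re z - a)\<^sup>2 > 0" by auto
    with re show False
      using zero_le_power2[of b] zero_le_power2[of c] zero_le_power2[of d] by simp
  qed
  with re show ?thesis by simp
qed

lemma quat_ball_eigenvalue:
  assumes "A \<in> quat_ball" "is_eigenvalue A z"
  shows "\<bar>Re z\<bar> + \<bar>Im z\<bar> \<le> 1"
proof -
  obtain a b c d where A: "A = quat a b c d" and le: "\<bar>a\<bar> + \<bar>b\<bar> + \<bar>c\<bar> + \<bar>d\<bar> \<le> 1"
    using assms(1) by (auto simp: quat_ball_def)
  have z: "Re z = a" "(Im z)\<^sup>2 = b\<^sup>2 + c\<^sup>2 + d\<^sup>2"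
    using quat_eigenvalue assms(2) A by blast+
  \<comment> \<open>Expanding the square on the right adds only nonnegative cross terms.\<close>
  have "\<bar>Im z\<bar>\<^sup>2 \<le> (\<bar>b\<bar> + \<bar>c\<bar> + \<bar>d\<bar>)\<^sup>2"
    unfolding power2_abs z(2) by (simp add: power2_eq_square algebra_simps flip: abs_mult)
  then have "\<bar>Im z\<bar> \<le> \<bar>b\<bar> + \<bar>c\<bar> + \<bar>d\<bar>"
    by (rule power2_le_imp_le) simp
  with le z(1) show ?thesis by simp
qed

text \<open>The matrix is diagonal with entries \<open>z\<close> and its conjugate, so the first
  basis vector is an eigenvector.\<close>

lemma quat_eigenvalue_diagonal: "is_eigenvalue (quat (Re z) (Im z) 0 0) z"
  unfolding is_eigenvalue_def
  by (rule exI[of _ "vector [1, 0]"])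
    (simp add: vec_eq_iff forall_2 matrix_vector_mult_def sum_2 quat_def complex_eq_iff)

lemma fourth_roots_of_unity: "{z::complex. z ^ 4 = 1} = {1, - 1, \<i>, - \<i>}"
proof -
  have "z ^ 4 - 1 = (z - 1) * (z + 1) * (z - \<i>) * (z + \<i>)" for z :: complex
    by (simp add: algebra_simps power4_eq_xxxx)
  then have "z ^ 4 = 1 \<longleftrightarrow> z = 1 \<or> z = - 1 \<or> z = \<i> \<or> z = - \<i>" for z :: complex
    by (metis (no_types, lifting) eq_iff_diff_eq_0 eq_neg_iff_add_eq_0 mult_eq_0_iff)
  then show ?thesis by auto
qed

lemma Pi_polygon_4I:
  assumes "\<bar>Re z\<bar> + \<bar>Im z\<bar> \<le> 1"
  shows "z \<in> Pi_polygon 4"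
proof -
  let ?P = "convex hull {1, - 1, \<i>, - \<i>}"
  \<comment> \<open>The weights are the positive and negative parts of \<open>Re z\<close> and
    \<open>Im z\<close>. Each gets a quarter \<open>t\<close> of the slack, which brings the total
    to 1 and leaves the point fixed, as the four vertices sum to 0.\<close>
  define t where "t = (1 - \<bar>Re z\<bar> - \<bar>Im z\<bar>) / 4"
  define w :: "nat \<Rightarrow> real" where "w = (\<lambda>n. [t + (\<bar>Re z\<bar> + Re z) / 2, t + (\<bar>Re z\<bar> - Re z) / 2,
    t + (\<bar>Im z\<bar> + Im z) / 2, t + (\<bar>Im z\<bar> - Im z) / 2] ! n)"
  define p :: "nat \<Rightarrow> complex" where "p = (\<lambda>n. [1, - 1, \<i>, - \<i>] ! n)"
  have [simp]: "{..<4} = {0, 1, 2, 3::nat}" by auto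
  have "t \<ge> 0" using assms by (simp add: t_def)
  have "(\<Sum>n<4. w n *\<^sub>R p n) \<in> ?P"
  proof (rule convex_sum)
    show "sum w {..<4} = 1" by (simp add: w_def t_def field_simps)
    show "w n \<ge> 0" if "n \<in> {..<4}" for n using that \<open>t \<ge> 0\<close> by (auto simp: w_def)
    show "p n \<in> ?P" if "n \<in> {..<4}" for n using that by (auto simp: p_def intro: hull_inc)
  qed auto
  also have "(\<Sum>n<4. w n *\<^sub>R p n) = z"
    by (simp add: w_def p_def complex_eq_iff field_simps)
  finally show ?thesis
    by (simp add: Pi_polygon_def fourth_roots_of_unity)
qed

locale Q8_representation =
  fixes \<rho> :: "Q8_generator word set \<Rightarrow> complex ^ 2 ^ 2"
  assumes hom: "\<rho> \<in> hom Q8 GL"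
    and r: "\<rho> Q8_r = rho_r"
    and s: "\<rho> Q8_s = rho_s"
begin

text \<open>Evaluating \<open>\<rho>\<close> on representatives makes induction over words
  available.\<close>

abbreviation word_image :: "Q8_generator word \<Rightarrow> complex ^ 2 ^ 2"
  where "word_image w \<equiv> \<rho> (pres_class Q8_relations w)"

lemma word_image_append: "word_image (u @ v) = word_image u ** word_image v"
  using hom_mult[OF hom, of "pres_class Q8_relations u" "pres_class Q8_relations v"]
  by (simp add: Q8_def carrier_presented_group pres_mult GL_def)

lemma word_image_Nil: "word_image [] = mat 1"
  using hom_one[OF hom] group_presented_group[of Q8_relations] group_GL
  by (simp add: Q8_def one_presented_group GL_def)

lemma word_image_generator:
  "word_image [(Q8_generator.r, True)] = rho_r" "word_image [(Q8_generator.s, True)] = rho_s"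
  using r s by (simp_all add: Q8_r_def Q8_s_def pres_gen_def)

text \<open>Each generator matrix squares to minus the identity, so its negative is a right inverse
  and agrees with the left inverse \<open>?B\<close>.\<close>

lemma word_image_inverse:
  "word_image [(x, False)] = - word_image [(x, True)]"
proof -
  let ?A = "word_image [(x, True)]" and ?B = "word_image [(x, False)]"
  have "?B ** ?A = mat 1"
    using pres_eq.cancel[of Q8_relations x False]
    by (simp add: word_image_Nil pres_class_eq_iff[symmetric] flip: word_image_append)
  then have "?B ** (?A ** - ?A) = - ?A"
    by (simp only: matrix_mul_assoc matrix_mul_lid)
  moreover have "?A ** - ?A = mat 1"
    by (cases x) (simp_all add: word_image_generator mat2_simps)
  ultimately show ?thesis
    by (simp only: matrix_mul_rid)
qed

lemma letter_image: "word_image [l] \<in> {rho_r, rho_s, - rho_r, - rho_s}"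
proof -
  obtain x b where "l = (x, b)" by (cases l)
  then show ?thesis
    by (cases x; cases b) (simp_all add: word_image_inverse word_image_generator)
qed

text \<open>Induction on the word: the identity lies in the ball, and each further letter multiplies
  from the left by a matrix that preserves it.\<close>

lemma image_subset_quat_ball: "\<rho> ` carrier Q8 \<subseteq> quat_ball"
proof -
  have "word_image w \<in> quat_ball" for w
  proof (induction w)
    case Nil
    have "quat 1 0 0 0 \<in> quat_ball" by (rule quat_ballI) simp
    then show ?case by (simp add: word_image_Nil quat_one)
  next
    case (Cons l w)
    then show ?case
      using quat_ball_mult_left[OF letter_image] word_image_append[of "[l]" w] by simp
  qed
  then show ?thesis by (auto simp: Q8_def carrier_presented_group)
qed

lemma hull_spectrum_subset: "hull_spectrum (\<rho> ` carrier Q8) \<subseteq> Pi_polygon 4"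
  using hull_minimal[of _ _ convex, OF image_subset_quat_ball convex_quat_ball]
  by (auto simp: hull_spectrum_def intro: Pi_polygon_4I quat_ball_eigenvalue)

text \<open>The fourth roots of unity correspond to the powers of \<open>r\<close>, here the words
  for 1, \<open>r\<close>, its square and its inverse.\<close>

lemma diagonal_quat_in_image:
  assumes "z ^ 4 = 1"
  shows "quat (Re z) (Im z) 0 0 \<in> \<rho> ` carrier Q8"
proof -
  let ?r = "(Q8_generator.r, True)"
  have *: "word_image w \<in> \<rho> ` carrier Q8" for w
    by (auto simp: Q8_def carrier_presented_group)
  have rr: "word_image [?r, ?r] = quat (- 1) 0 0 0"
    using word_image_append[of "[?r]" "[?r]"] by (simp add: word_image_generator mat2_simps)
  have "word_image [] = quat 1 0 0 0" by (simp add: word_image_Nil quat_one)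
  moreover have "word_image [?r] = quat 0 1 0 0"
    by (simp add: word_image_generator mat2_simps)
  moreover have "word_image [(Q8_generator.r, False)] = quat 0 (- 1) 0 0"
    by (simp add: word_image_inverse word_image_generator mat2_simps)
  moreover have "z \<in> {1, - 1, \<i>, - \<i>}"
    using assms fourth_roots_of_unity by blast
  ultimately show ?thesis
    using rr *[of "[]"] *[of "[?r]"] *[of "[(Q8_generator.r, False)]"] *[of "[?r, ?r]"] by auto
qed

lemma Pi_polygon_subset: "Pi_polygon 4 \<subseteq> hull_spectrum (\<rho> ` carrier Q8)"
proof
  fix z assume "z \<in> Pi_polygon 4"
  let ?D = "\<lambda>z. quat (Re z) (Im z) 0 0"
  \<comment> \<open>Real linearity lets \<open>?D\<close> commute with convex hulls, so sending the
    vertices into the image sends all of \<Pi>4 into its hull.\<close>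
  have "linear ?D"
    by (rule linearI) (simp_all add: mat2_simps)
  then have "?D ` Pi_polygon 4 = convex hull (?D ` {z. z ^ 4 = 1})"
    unfolding Pi_polygon_def by (rule convex_hull_linear_image)
  also have "\<dots> \<subseteq> convex hull (\<rho> ` carrier Q8)"
    by (intro hull_mono) (auto intro: diagonal_quat_in_image)
  finally show "z \<in> hull_spectrum (\<rho> ` carrier Q8)"
    using \<open>z \<in> Pi_polygon 4\<close> quat_eigenvalue_diagonal by (auto simp: hull_spectrum_def)
qed

end

theorem theorem6p2:
  fixes \<rho> :: "Q8_generator word set \<Rightarrow> complex ^ 2 ^ 2"
  assumes "\<rho> \<in> hom Q8 GL"
    and "\<rho> Q8_r = rho_r"
    and "\<rho> Q8_s = rho_s"
  shows "hull_spectrum (\<rho> ` carrier Q8) = Pi_polygon 4"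
proof -
  interpret Q8_representation \<rho> using assms by unfold_locales
  show ?thesis using hull_spectrum_subset Pi_polygon_subset by blast
qed

end
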